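(* Let $\Phi=(G,\varphi)$ be a connected $\mathbb{T}$-gain graph on $n$ vertices, and let $\mathbf{C}=\operatorname{diag}(c_1,c_2,\dots,c_n)\in\mathbb{C}^{n\times n}$ be an invertible diagonal matrix. Then $$\lambda_n(\Phi)\le\max_{1\le i\le n}\left\{d_i+\sum_{j:\,v_j\sim v_i}\frac{|c_j|}{|c_i|}\right\},$$ where $d_i$ is the degree of the vertex $v_i$ in $G$ and $\lambda_n(\Phi)$ is the largest eigenvalue of the gain Laplacian $\mathbf{L}(\Phi)$.
   Context: A $\mathbb{T}$-gain graph (complex unit gain graph) $\Phi=(G,\varphi)$ consists of a finite simple undirected graph $G$ with vertices $v_1,\dots,v_n$ and a map $\varphi$ assigning to each oriented edge $\overrightarrow{e}_{ij}$ (from $v_i$ to $v_j$, where $v_i\sim v_j$) a complex number of modulus $1$, with $\varphi(\overrightarrow{e}_{ji})=\varphi(\overrightarrow{e}_{ij})^{-1}$. Connected means that $G$ is connected. The adjacency matrix $\mathbf{A}(\Phi)=(a_{ij})$ has $a_{ij}=\varphi(\overrightarrow{e}_{ij})$ if $v_i\sim v_j$ and $a_{ij}=0$ otherwise. The gain Laplacian is $\mathbf{L}(\Phi)=\mathbf{D}(G)-\mathbf{A}(\Phi)$, where $\mathbf{D}(G)=\operatorname{diag}(d_1,\dots,d_n)$; it is Hermitian positive semidefinite with eigenvalues $0\le\lambda_1(\Phi)\le\dots\le\lambda_n(\Phi)$. *)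

theory Defs
  imports "Jordan_Normal_Form.Spectral_Radius" "Graph_Theory.Graph_Theory"
begin

text \<open>
  A finite simple undirected graph is a \<^locale>\<open>pair_graph\<close>: a finite, loop-free, symmetric
  digraph whose arcs are ordered pairs, so that the two arcs (i, j) and (j, i) are
  the two orientations of one edge. The vertices are numbered 0, ..., n - 1 in order to serve as
  row and column indices. Values of the gain function outside the arc set are irrelevant.
\<close>

locale gain_graph = pair_graph G
  for n :: nat and G :: "nat pair_pre_digraph" and \<phi> :: "nat \<times> nat \<Rightarrow> complex" +
  assumes verts_eq: "pverts G = {..<n}"
    and gain_unit: "(i, j) \<in> parcs G \<Longrightarrow> cmod (\<phi> (i, j)) = 1"
    and gain_inverse: "(i, j) \<in> parcs G \<Longrightarrow> \<phi> (j, i) = inverse (\<phi> (i, j))"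

text \<open>In a symmetric digraph the out-degree is the degree of the underlying undirected graph.\<close>

definition vertex_degree :: "nat pair_pre_digraph \<Rightarrow> nat \<Rightarrow> nat" where
  "vertex_degree G i = out_degree (with_proj G) i"

definition degree_mat :: "nat \<Rightarrow> nat pair_pre_digraph \<Rightarrow> complex mat" where
  "degree_mat n G = mat_diag n (\<lambda>i. of_nat (vertex_degree G i))"

definition gain_adjacency ::
  "nat \<Rightarrow> nat pair_pre_digraph \<Rightarrow> (nat \<times> nat \<Rightarrow> complex) \<Rightarrow> complex mat" where
  "gain_adjacency n G \<phi> = mat n n (\<lambda>(i, j). if (i, j) \<in> parcs G then \<phi> (i, j) else 0)"

definition gain_laplacian ::
  "nat \<Rightarrow> nat pair_pre_digraph \<Rightarrow> (nat \<times> nat \<Rightarrow> complex) \<Rightarrow> complex mat" where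
  "gain_laplacian n G \<phi> = degree_mat n G - gain_adjacency n G \<phi>"

text \<open>
  The eigenvalues are a priori complex, hence the embedding; that they are all real, and that the
  maximum is over a nonempty finite set, is shown at the end of this theory.
\<close>

definition largest_eigenvalue :: "complex mat \<Rightarrow> real" where
  "largest_eigenvalue A = Max {x. complex_of_real x \<in> spectrum A}"

lemma gain_laplacian_carrier: "gain_laplacian n G \<phi> \<in> carrier_mat n n"
  unfolding gain_laplacian_def gain_adjacency_def by (intro minus_carrier_mat mat_carrier)

lemma gain_laplacian_index:
  assumes "i < n" "j < n"
  shows "gain_laplacian n G \<phi> $$ (i, j) =
    (if i = j then of_nat (vertex_degree G i) else 0) - (if (i, j) \<in> parcs G then \<phi> (i, j) else 0)"
  using assms
  by (simp add: gain_laplacian_def degree_mat_def gain_adjacency_def mat_diag_def)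

context gain_graph
begin

lemma parcs_sym: "(i, j) \<in> parcs G \<Longrightarrow> (j, i) \<in> parcs G"
  using pair_sym_arcs by (simp add: symmetric_def sym_def)

lemma gain_laplacian_hermitian:
  assumes "i < n" "j < n"
  shows "gain_laplacian n G \<phi> $$ (j, i) = cnj (gain_laplacian n G \<phi> $$ (i, j))"
proof -
  have *: "\<phi> (j, i) = cnj (\<phi> (i, j))" if "(i, j) \<in> parcs G"
  proof -
    have "\<phi> (i, j) * cnj (\<phi> (i, j)) = 1"
      using gain_unit[OF that] by (simp add: complex_norm_square[symmetric])
    then have "cnj (\<phi> (i, j)) = inverse (\<phi> (i, j))"
      by (metis inverse_unique)
    then show ?thesis using gain_inverse[OF that] by simp
  qed
  show ?thesis
    using assms parcs_sym[of i j] parcs_sym[of j i] *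
    by (auto simp: gain_laplacian_index)
qed

lemma spectrum_gain_laplacian_real:
  assumes "k \<in> spectrum (gain_laplacian n G \<phi>)"
  shows "k \<in> \<real>"
proof -
  let ?L = "gain_laplacian n G \<phi>"
  have dim: "?L \<in> carrier_mat n n" by (rule gain_laplacian_carrier)
  from assms obtain v where "eigenvector ?L v k"
    by (auto simp: spectrum_def eigenvalue_def)
  then have v: "v \<in> carrier_vec n" "v \<noteq> 0\<^sub>v n" and ev: "?L *\<^sub>v v = k \<cdot>\<^sub>v v"
    using dim by (auto simp: eigenvector_def)
  have row: "(\<Sum>j<n. ?L $$ (i, j) * v $ j) = k * v $ i" if "i < n" for i
  proof -
    have "(?L *\<^sub>v v) $ i = (\<Sum>j<n. ?L $$ (i, j) * v $ j)"
      using that dim v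
      by (auto simp: scalar_prod_def row_def atLeast0LessThan intro!: sum.cong)
    then show ?thesis using ev that v by simp
  qed
  define q where "q = (\<Sum>i<n. \<Sum>j<n. cnj (v $ i) * ?L $$ (i, j) * v $ j)"
  define s where "s = (\<Sum>i<n. (cmod (v $ i))\<^sup>2)"
  have "q = (\<Sum>i<n. cnj (v $ i) * (\<Sum>j<n. ?L $$ (i, j) * v $ j))"
    by (simp add: q_def sum_distrib_left mult.assoc)
  also have "\<dots> = (\<Sum>i<n. k * (v $ i * cnj (v $ i)))"
    by (intro sum.cong) (auto simp: row)
  also have "\<dots> = k * of_real s"
    by (simp add: s_def sum_distrib_left complex_norm_square flip: of_real_power)
  finally have q1: "q = k * of_real s" .
  have "cnj q = (\<Sum>i<n. \<Sum>j<n. cnj (v $ j) * ?L $$ (j, i) * v $ i)"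
    unfolding q_def cnj_sum
  proof (intro sum.cong refl)
    fix i j assume "i \<in> {..<n}" "j \<in> {..<n}"
    then have "cnj (?L $$ (i, j)) = ?L $$ (j, i)"
      by (simp only: lessThan_iff gain_laplacian_hermitian[of i j])
    then show "cnj (cnj (v $ i) * ?L $$ (i, j) * v $ j) = cnj (v $ j) * ?L $$ (j, i) * v $ i"
      by (simp only: complex_cnj_mult complex_cnj_cnj mult.commute mult.left_commute)
  qed
  also have "\<dots> = q"
    unfolding q_def by (rule sum.swap)
  finally have "cnj q = q" .
  then have "cnj k * of_real s = k * of_real s" by (simp add: q1)
  moreover have "s \<noteq> 0"
  proof
    assume "s = 0"
    then have "\<forall>i<n. v $ i = 0" by (simp add: s_def sum_nonneg_eq_0_iff)
    then have "v = 0\<^sub>v n" using v by (intro eq_vecI) auto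
    with v show False by simp
  qed
  ultimately show ?thesis by (simp add: Reals_cnj_iff)
qed

lemma
  assumes "n > 0"
  shows largest_eigenvalue_in_spectrum:
      "complex_of_real (largest_eigenvalue (gain_laplacian n G \<phi>)) \<in> spectrum (gain_laplacian n G \<phi>)"
    and largest_eigenvalue_upper:
      "k \<in> spectrum (gain_laplacian n G \<phi>) \<Longrightarrow> Re k \<le> largest_eigenvalue (gain_laplacian n G \<phi>)"
proof -
  let ?L = "gain_laplacian n G \<phi>" and ?S = "{x. complex_of_real x \<in> spectrum (gain_laplacian n G \<phi>)}"
  have fin: "finite ?S"
    using finite_vimageI[OF card_finite_spectrum(1)[OF gain_laplacian_carrier] inj_of_real]
    by (simp add: vimage_def)
  have real: "Re k \<in> ?S" if "k \<in> spectrum ?L" for k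
    using that spectrum_gain_laplacian_real[OF that] by simp
  have "?S \<noteq> {}"
    using spectrum_non_empty[OF gain_laplacian_carrier assms] real by blast
  from Max_in[OF fin this]
  show "complex_of_real (largest_eigenvalue ?L) \<in> spectrum ?L"
    by (simp add: largest_eigenvalue_def)
  show "k \<in> spectrum ?L \<Longrightarrow> Re k \<le> largest_eigenvalue ?L"
    unfolding largest_eigenvalue_def by (rule Max_ge[OF fin real])
qed

end

end

theory Submission
  imports Defs
begin

text \<open>
  Let \<open>v\<close> be an eigenvector for the largest eigenvalue \<open>x\<close> and let \<open>i\<close> maximise
  \<open>\<bar>v\<^sub>i\<bar> / \<bar>c\<^sub>i\<bar>\<close>. Row \<open>i\<close> of the eigenvalue equation gives
  \<open>\<bar>x - d\<^sub>i\<bar> \<bar>v\<^sub>i\<bar> \<le> \<Sum>\<bar>v\<^sub>j\<bar>\<close> over the neighbours \<open>j\<close> of \<open>i\<close>, where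
  \<open>\<bar>v\<^sub>j\<bar> \<le> \<bar>c\<^sub>j\<bar> \<bar>v\<^sub>i\<bar> / \<bar>c\<^sub>i\<bar>\<close>. (This is Gershgorin's theorem for the conjugate of the
  Laplacian by the diagonal matrix.)
\<close>

text \<open>The diagonal entry at \<open>i\<close> of the product with an inverse is
  \<open>c i\<close> times a scalar, and it must equal 1.\<close>

lemma invertible_mat_diag_nonzero:
  fixes c :: "nat \<Rightarrow> 'a :: semiring_1"
  assumes "invertible_mat (mat_diag n c)" "i < n"
  shows "c i \<noteq> 0"
proof
  assume "c i = 0"
  from assms(1) obtain B where AB: "mat_diag n c * B = 1\<^sub>m n"
    and BA: "B * mat_diag n c = 1\<^sub>m (dim_row B)"
    unfolding invertible_mat_def inverts_mat_def by (auto simp: mat_diag_def)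
  \<comment> \<open>\<open>inverts_mat\<close> does not fix the size of \<open>B\<close>; comparing
    dimensions in the two identities forces it to be square of order \<open>n\<close>.\<close>
  have "dim_col B = n" using arg_cong[OF AB, of dim_col] by simp
  moreover have "dim_row B = n" using arg_cong[OF BA, of dim_col] by (simp add: mat_diag_def)
  ultimately have "B \<in> carrier_mat n n" by auto
  then have "(mat_diag n c * B) $$ (i, i) = c i * B $$ (i, i)"
    using assms(2) by (simp add: mat_diag_mult_left)
  with AB \<open>c i = 0\<close> assms(2) show False by simp
qed

lemma eigenvector_weighted_max:
  fixes v :: "complex vec" and c :: "nat \<Rightarrow> complex"
  assumes "v \<in> carrier_vec n" "v \<noteq> 0\<^sub>v n"
    and c: "\<And>i. i < n \<Longrightarrow> c i \<noteq> 0"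
  obtains i where "i < n" "v $ i \<noteq> 0"
    "\<And>j. j < n \<Longrightarrow> cmod (v $ j) \<le> cmod (c j) / cmod (c i) * cmod (v $ i)"
proof -
  let ?w = "\<lambda>i. cmod (v $ i) / cmod (c i)"
  obtain k where k: "k < n" "v $ k \<noteq> 0"
    using assms(1,2) by (metis eq_vecI carrier_vecD index_zero_vec)
  let ?W = "?w ` {..<n}"
  have "Max ?W \<in> ?W" using k(1) by (intro Max_in) auto
  then obtain i where i: "i < n" "?w i = Max ?W" by force
  have max: "?w j \<le> ?w i" if "j < n" for j
    using that i(2) by simp
  \<comment> \<open>A nonzero entry of \<open>v\<close> makes the maximal ratio positive, so the
    maximiser is itself a nonzero entry.\<close>
  have "0 < ?w k" using k c by simp
  then have "v $ i \<noteq> 0" using max[OF k(1)] by auto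
  moreover have "cmod (v $ j) \<le> cmod (c j) / cmod (c i) * cmod (v $ i)" if "j < n" for j
    using max[OF that] c[OF that] by (simp add: field_simps)
  ultimately show thesis using that i(1) by blast
qed

context gain_graph
begin

lemma gain_laplacian_mult_vec_index:
  assumes "v \<in> carrier_vec n" "i < n"
  shows "(gain_laplacian n G \<phi> *\<^sub>v v) $ i =
    of_nat (vertex_degree G i) * v $ i - (\<Sum>j | (i, j) \<in> parcs G. \<phi> (i, j) * v $ j)"
proof -
  let ?L = "gain_laplacian n G \<phi>"
  have sub: "{j. (i, j) \<in> parcs G} \<subseteq> {..<n}"
    using in_arcsD2 verts_eq by auto
  have "(?L *\<^sub>v v) $ i = (\<Sum>j<n. ?L $$ (i, j) * v $ j)"
    using assms gain_laplacian_carrier[of n G \<phi>]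
    by (auto simp: scalar_prod_def row_def atLeast0LessThan intro!: sum.cong)
  \<comment> \<open>Writing adjacency as set membership lets \<open>sum.inter_restrict\<close>
    shrink the second sum to the neighbours of \<open>i\<close>.\<close>
  also have "\<dots> = (\<Sum>j<n. (if i = j then of_nat (vertex_degree G i) * v $ j else 0)
      - (if j \<in> {j. (i, j) \<in> parcs G} then \<phi> (i, j) * v $ j else 0))"
    using assms by (intro sum.cong) (auto simp: gain_laplacian_index algebra_simps)
  also have "\<dots> = of_nat (vertex_degree G i) * v $ i
      - (\<Sum>j | (i, j) \<in> parcs G. \<phi> (i, j) * v $ j)"
    unfolding sum_subtractf using assms(2) sub
    by (simp add: sum.inter_restrict[symmetric] Int_absorb1 del: mem_Collect_eq)
  finally show ?thesis .
qed

text \<open>The bound holds for every real eigenvalue, with a row \<open>i\<close> that may depend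
  on it.\<close>

lemma gain_laplacian_eigenvalue_weighted_bound:
  fixes c :: "nat \<Rightarrow> complex" and x :: real
  assumes "eigenvalue (gain_laplacian n G \<phi>) (of_real x)"
    and c: "\<And>i. i < n \<Longrightarrow> c i \<noteq> 0"
  obtains i where "i < n"
    "x \<le> real (vertex_degree G i) + (\<Sum>j | (i, j) \<in> parcs G. cmod (c j) / cmod (c i))"
proof -
  from assms(1) obtain v where v: "v \<in> carrier_vec n" "v \<noteq> 0\<^sub>v n"
    and ev: "gain_laplacian n G \<phi> *\<^sub>v v = of_real x \<cdot>\<^sub>v v"
    using gain_laplacian_carrier[of n G \<phi>] by (auto simp: eigenvalue_def eigenvector_def)
  from eigenvector_weighted_max[where c = c, OF v c] obtain i where i: "i < n" "v $ i \<noteq> 0"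
    and max: "\<And>j. j < n \<Longrightarrow> cmod (v $ j) \<le> cmod (c j) / cmod (c i) * cmod (v $ i)"
    by blast
  let ?d = "real (vertex_degree G i)" and ?N = "{j. (i, j) \<in> parcs G}"
  have "of_real (?d - x) * v $ i = (\<Sum>j\<in>?N. \<phi> (i, j) * v $ j)"
    using gain_laplacian_mult_vec_index[OF v(1) i(1)] ev i(1) v(1) by (simp add: algebra_simps)
  then have "\<bar>?d - x\<bar> * cmod (v $ i) = cmod (\<Sum>j\<in>?N. \<phi> (i, j) * v $ j)"
    by (metis norm_mult norm_of_real)
  \<comment> \<open>Triangle inequality: gains have modulus 1, so only the entries of
    \<open>v\<close> remain to be estimated.\<close>
  also have "\<dots> \<le> (\<Sum>j\<in>?N. cmod (c j) / cmod (c i) * cmod (v $ i))"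
  proof (rule sum_norm_le)
    fix j assume "j \<in> ?N"
    then have "(i, j) \<in> parcs G" "j < n" using in_arcsD2 verts_eq by auto
    then show "cmod (\<phi> (i, j) * v $ j) \<le> cmod (c j) / cmod (c i) * cmod (v $ i)"
      using max by (simp add: norm_mult gain_unit)
  qed
  also have "\<dots> = (\<Sum>j\<in>?N. cmod (c j) / cmod (c i)) * cmod (v $ i)"
    by (simp add: sum_distrib_right)
  \<comment> \<open>The common factor \<open>cmod (v $ i)\<close> is positive and cancels.\<close>
  finally have "\<bar>?d - x\<bar> \<le> (\<Sum>j\<in>?N. cmod (c j) / cmod (c i))"
    using i(2) by simp
  then show thesis using that[OF i(1)] by linarith
qed

end

theorem theorem5p5:
  fixes n :: nat and G :: "nat pair_pre_digraph" and \<phi> :: "nat \<times> nat \<Rightarrow> complex"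
    and c :: "nat \<Rightarrow> complex"
  assumes "gain_graph n G \<phi>"
    and "connected (with_proj G)"
    and "invertible_mat (mat_diag n c)"
  shows "largest_eigenvalue (gain_laplacian n G \<phi>)
    \<le> Max ((\<lambda>i. real (vertex_degree G i) + (\<Sum>j | (i, j) \<in> parcs G. cmod (c j) / cmod (c i))) ` {..<n})"
    (is "_ \<le> Max (?f ` _)")
proof -
  interpret gain_graph n G \<phi> by fact
  \<comment> \<open>Connectedness includes having a vertex, so the spectrum is nonempty and the
    largest eigenvalue is attained.\<close>
  have "pverts G \<noteq> {}"
    using assms(2) by (auto simp: connected_def strongly_connected_def)
  then have "n > 0" using verts_eq by auto
  from largest_eigenvalue_in_spectrum[OF this]
  have "eigenvalue (gain_laplacian n G \<phi>) (of_real (largest_eigenvalue (gain_laplacian n G \<phi>)))"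
    by (simp add: spectrum_def)
  from gain_laplacian_eigenvalue_weighted_bound[where c = c, OF this
      invertible_mat_diag_nonzero[OF assms(3)]]
  obtain i where "i < n" "largest_eigenvalue (gain_laplacian n G \<phi>) \<le> ?f i" by blast
  then show ?thesis by (intro Max_ge_iff[THEN iffD2]) auto
qed

end
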